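(* Let $r\ge 1$ and $m\ge 1$ be integers and let $G=G(3^{[r]};m)$. Then $$\chi_{la}(G)=\begin{cases}3 & \text{if } G=G(3^{[r]};1) \text{ or } G=G(3^{[2]};2),\\ 4 & \text{if } G=G(3^{[r]};2),\ r\ge 3,\\ m+1 & \text{if } m\ge\binom{r}{2}\ge 3,\\ m+2 & \text{if } 3\le m<\binom{r}{2}.\end{cases}$$
   Context: A local antimagic labeling of a connected graph $G=(V,E)$ is a bijection $f:E\to\{1,\dots,|E|\}$ such that, with $f^+(u)=\sum f(e)$ (sum over all edges $e$ incident to $u$), one has $f^+(u)\neq f^+(v)$ for every pair of adjacent vertices $u,v$. The color number $c(f)$ is the number of distinct values of $f^+$ on $V$. The local antimagic chromatic number $\chi_{la}(G)$ is the minimum of $c(f)$ over all local antimagic labelings $f$ of $G$. The graph $GB(3^{[r]})$ is the edge-gluing of $r$ triangles at a common edge $uv$: it has vertices $u,v,x_1,\dots,x_r$ and edges $uv$, $ux_i$, $vx_i$ for $1\le i\le r$. The graph $G(3^{[r]};m)$ is obtained from $GB(3^{[r]})$ by adding $m$ new pendant (degree-one) vertices $y_1,\dots,y_m$, each joined by an edge to $u$. *)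

theory Defs
  imports Main
begin

text \<open>
  A simple graph is given by its vertex set \<open>V\<close> and its set \<open>E\<close> of edges,
  an edge being the two-element set of its endpoints.
\<close>

definition simple_graph :: "'a set \<Rightarrow> 'a set set \<Rightarrow> bool" where
  "simple_graph V E \<longleftrightarrow> finite V \<and> (\<forall>e\<in>E. e \<subseteq> V \<and> card e = 2)"

definition connected_graph :: "'a set \<Rightarrow> 'a set set \<Rightarrow> bool" where
  "connected_graph V E \<longleftrightarrow> simple_graph V E \<and> V \<noteq> {} \<and>
     (\<forall>u\<in>V. \<forall>v\<in>V. (u, v) \<in> {(x, y). {x, y} \<in> E}\<^sup>*)"

definition induced_label :: "'a set set \<Rightarrow> ('a set \<Rightarrow> nat) \<Rightarrow> 'a \<Rightarrow> nat" where
  "induced_label E f u = (\<Sum>e | e \<in> E \<and> u \<in> e. f e)"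

definition local_antimagic_labeling :: "'a set \<Rightarrow> 'a set set \<Rightarrow> ('a set \<Rightarrow> nat) \<Rightarrow> bool" where
  "local_antimagic_labeling V E f \<longleftrightarrow>
     connected_graph V E \<and> bij_betw f E {1..card E} \<and>
     (\<forall>u\<in>V. \<forall>v\<in>V. {u, v} \<in> E \<longrightarrow> induced_label E f u \<noteq> induced_label E f v)"

definition color_number :: "'a set \<Rightarrow> 'a set set \<Rightarrow> ('a set \<Rightarrow> nat) \<Rightarrow> nat" where
  "color_number V E f = card (induced_label E f ` V)"

text \<open>
  The infimum of a nonempty set of naturals is attained, so this is the minimum
  whenever a local antimagic labeling exists. The infimum of the empty set is \<open>0\<close>, while
  a labeling of a (nonempty) connected graph has positive color number, so \<open>\<chi>\<^sub>l\<^sub>a\<close> can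
  only be positive if a labeling exists.
\<close>

definition chi_la :: "'a set \<Rightarrow> 'a set set \<Rightarrow> nat" where
  "chi_la V E = Inf {color_number V E f | f. local_antimagic_labeling V E f}"

datatype vertex = Vu | Vv | Vx nat | Vy nat

definition GB3_verts :: "nat \<Rightarrow> vertex set" where
  "GB3_verts r = {Vu, Vv} \<union> {Vx i | i. 1 \<le> i \<and> i \<le> r}"

definition GB3_edges :: "nat \<Rightarrow> vertex set set" where
  "GB3_edges r = {{Vu, Vv}} \<union> {{Vu, Vx i} | i. 1 \<le> i \<and> i \<le> r} \<union> {{Vv, Vx i} | i. 1 \<le> i \<and> i \<le> r}"

definition G3_verts :: "nat \<Rightarrow> nat \<Rightarrow> vertex set" where
  "G3_verts r m = GB3_verts r \<union> {Vy j | j. 1 \<le> j \<and> j \<le> m}"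

definition G3_edges :: "nat \<Rightarrow> nat \<Rightarrow> vertex set set" where
  "G3_edges r m = GB3_edges r \<union> {{Vu, Vy j} | j. 1 \<le> j \<and> j \<le> m}"

lemma finite_G3_verts: "finite (G3_verts r m)"
proof -
  have "G3_verts r m = {Vu, Vv} \<union> Vx ` {1..r} \<union> Vy ` {1..m}"
    by (auto simp: G3_verts_def GB3_verts_def)
  then show ?thesis by simp
qed

lemma connected_G3: "connected_graph (G3_verts r m) (G3_edges r m)"
proof -
  let ?R = "{(x, y). {x, y} \<in> G3_edges r m}"
  have R: "(Vu, v) \<in> ?R\<^sup>*" if "v \<in> G3_verts r m" for v
  proof (cases "v = Vu")
    case False
    then have "{Vu, v} \<in> G3_edges r m"
      using that by (auto simp: G3_verts_def GB3_verts_def G3_edges_def GB3_edges_def)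
    then show ?thesis by blast
  qed simp
  have "sym ?R" by (auto simp: sym_def insert_commute)
  then have "sym (?R\<^sup>*)" by (rule sym_rtrancl)
  then have "(u, v) \<in> ?R\<^sup>*" if "u \<in> G3_verts r m" "v \<in> G3_verts r m" for u v
    using R[OF that(1)] R[OF that(2)] by (meson rtrancl_trans symD)
  moreover have "simple_graph (G3_verts r m) (G3_edges r m)"
    using finite_G3_verts[of r m] unfolding simple_graph_def
    by (auto simp: G3_verts_def GB3_verts_def G3_edges_def GB3_edges_def)
  moreover have "G3_verts r m \<noteq> {}" by (simp add: G3_verts_def GB3_verts_def)
  ultimately show ?thesis unfolding connected_graph_def by blast
qed

end

theory Submission
  imports Defs
begin

text \<open>
  The pendant labels are pairwise distinct and smaller than \<open>f\<^sup>+(u)\<close>, so there are at least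
  \<open>m + 1\<close> colors; with exactly \<open>m + 1\<close> colors \<open>f\<^sup>+(v)\<close> is itself a pendant label, so
  \<open>1 + \<dots> + (r + 1) \<le> f\<^sup>+(v) \<le> 2r + m + 1\<close>, i.e. \<open>r choose 2 \<le> m\<close>.
  Conversely, one labeling serves for all \<open>r \<noteq> 2\<close>: put \<open>r + 1\<close> on \<open>uv\<close>, the largest \<open>m\<close> labels
  on the pendant edges, and \<open>i\<close> and \<open>2r + 2 - i\<close> on \<open>vx\<^sub>i\<close> and \<open>ux\<^sub>i\<close>. Every \<open>x\<^sub>i\<close> then gets the
  color \<open>2r + 2\<close>, which is a pendant label, and \<open>f\<^sup>+(v) = (r + 1)(r + 2) / 2\<close> is a pendant label
  as soon as \<open>m \<ge> r choose 2\<close>. For \<open>r = 2\<close> this clashes (\<open>f\<^sup>+(v) = 6 = 2r + 2\<close>), and ad hoc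
  labelings are used.
\<close>

section \<open>Edges, vertices and colors in coordinates\<close>

lemma G3_edges_alt:
  "G3_edges r m = insert {Vu, Vv} ((\<lambda>i. {Vu, Vx i}) ` {1..r} \<union> (\<lambda>i. {Vv, Vx i}) ` {1..r}
     \<union> (\<lambda>j. {Vu, Vy j}) ` {1..m})"
  by (auto simp: G3_edges_def GB3_edges_def)

lemma G3_verts_alt:
  "G3_verts r m = {Vu, Vv} \<union> Vx ` {1..r} \<union> Vy ` {1..m}"
  by (auto simp: G3_verts_def GB3_verts_def)

lemma finite_G3_edges: "finite (G3_edges r m)"
  by (simp add: G3_edges_alt)

lemma G3_edgesI:
  "{Vu, Vv} \<in> G3_edges r m"
  "i \<in> {1..r} \<Longrightarrow> {Vu, Vx i} \<in> G3_edges r m"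
  "i \<in> {1..r} \<Longrightarrow> {Vv, Vx i} \<in> G3_edges r m"
  "j \<in> {1..m} \<Longrightarrow> {Vu, Vy j} \<in> G3_edges r m"
  by (auto simp: G3_edges_alt)

lemma G3_edges_cases:
  assumes "e \<in> G3_edges r m"
  shows "e = {Vu, Vv} \<or> (\<exists>i\<in>{1..r}. e = {Vu, Vx i} \<or> e = {Vv, Vx i}) \<or> (\<exists>j\<in>{1..m}. e = {Vu, Vy j})"
  using assms by (auto simp: G3_edges_alt)

lemma inj_on_spokes:
  "inj_on (\<lambda>i. {Vu, Vx i}) A" "inj_on (\<lambda>i. {Vv, Vx i}) A" "inj_on (\<lambda>j. {Vu, Vy j}) A"
  by (auto simp: inj_on_def doubleton_eq_iff)

lemma card_G3_edges: "card (G3_edges r m) = 2 * r + m + 1"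
proof -
  let ?A = "(\<lambda>i. {Vu, Vx i}) ` {1..r}" and ?B = "(\<lambda>i. {Vv, Vx i}) ` {1..r}"
    and ?P = "(\<lambda>j. {Vu, Vy j}) ` {1..m}"
  have "?A \<inter> ?B = {}" "(?A \<union> ?B) \<inter> ?P = {}" "{Vu, Vv} \<notin> ?A \<union> ?B \<union> ?P"
    by (auto simp: doubleton_eq_iff)
  then have "card (insert {Vu, Vv} (?A \<union> ?B \<union> ?P)) = Suc (card ?A + card ?B + card ?P)"
    by (simp add: card_Un_disjoint)
  then show ?thesis
    by (simp add: G3_edges_alt card_image inj_on_spokes)
qed

lemma edges_at_Vv:
  "{e \<in> G3_edges r m. Vv \<in> e} = insert {Vu, Vv} ((\<lambda>i. {Vv, Vx i}) ` {1..r})"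
  by (auto simp: G3_edges_alt)

lemma induced_label_Vv:
  "induced_label (G3_edges r m) f Vv = f {Vu, Vv} + (\<Sum>i = 1..r. f {Vv, Vx i})"
proof -
  have "{Vu, Vv} \<notin> (\<lambda>i. {Vv, Vx i}) ` {1..r}"
    by (auto simp: doubleton_eq_iff)
  then show ?thesis
    by (simp add: induced_label_def edges_at_Vv sum.reindex inj_on_spokes)
qed

lemma induced_label_Vu:
  "induced_label (G3_edges r m) f Vu =
     f {Vu, Vv} + (\<Sum>i = 1..r. f {Vu, Vx i}) + (\<Sum>j = 1..m. f {Vu, Vy j})"
proof -
  let ?A = "(\<lambda>i. {Vu, Vx i}) ` {1..r}" and ?P = "(\<lambda>j. {Vu, Vy j}) ` {1..m}"
  have "{e \<in> G3_edges r m. Vu \<in> e} = insert {Vu, Vv} (?A \<union> ?P)"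
    by (auto simp: G3_edges_alt)
  moreover have "{Vu, Vv} \<notin> ?A \<union> ?P" "?A \<inter> ?P = {}"
    by (auto simp: doubleton_eq_iff)
  ultimately show ?thesis
    by (simp add: induced_label_def sum.union_disjoint sum.reindex inj_on_spokes)
qed

lemma induced_label_Vx:
  assumes "i \<in> {1..r}"
  shows "induced_label (G3_edges r m) f (Vx i) = f {Vu, Vx i} + f {Vv, Vx i}"
proof -
  have "{e \<in> G3_edges r m. Vx i \<in> e} = {{Vu, Vx i}, {Vv, Vx i}}"
    using assms by (auto simp: G3_edges_alt)
  moreover have "{Vu, Vx i} \<noteq> {Vv, Vx i}"
    by (auto simp: doubleton_eq_iff)
  ultimately show ?thesis
    by (simp add: induced_label_def)
qed

lemma induced_label_Vy:
  assumes "j \<in> {1..m}"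
  shows "induced_label (G3_edges r m) f (Vy j) = f {Vu, Vy j}"
proof -
  have "{e \<in> G3_edges r m. Vy j \<in> e} = {{Vu, Vy j}}"
    using assms by (auto simp: G3_edges_alt)
  then show ?thesis
    by (simp add: induced_label_def)
qed

text \<open>The labeling \<open>f\<close> does double duty: it bounds the infimum from above and
  makes the set nonempty, so that the infimum is attained and inherits the lower bound
  \<open>k\<close>.\<close>

lemma chi_la_eqI:
  assumes "local_antimagic_labeling V E f" "color_number V E f \<le> k"
    and "\<And>g. local_antimagic_labeling V E g \<Longrightarrow> k \<le> color_number V E g"
  shows "chi_la V E = k"
proof -
  let ?C = "{color_number V E f | f. local_antimagic_labeling V E f}"
  have "Inf ?C \<in> ?C"
    using assms(1) by (intro Inf_nat_def1) auto
  then have "k \<le> Inf ?C"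
    using assms(3) by auto
  moreover have "Inf ?C \<le> color_number V E f"
    using assms(1) by (intro wellorder_Inf_le1) auto
  ultimately show ?thesis
    using assms(2) by (simp add: chi_la_def)
qed

section \<open>Lower bounds on the number of colors\<close>

text \<open>The vertices \<open>Vu\<close>, \<open>Vv\<close>, \<open>Vx 1\<close> form a
  triangle.\<close>

lemma color_number_ge_3:
  assumes "r \<ge> 1" and f: "local_antimagic_labeling (G3_verts r m) (G3_edges r m) f"
  shows "3 \<le> color_number (G3_verts r m) (G3_edges r m) f"
proof -
  let ?c = "induced_label (G3_edges r m) f"
  have neq: "?c x \<noteq> ?c y" if "x \<in> G3_verts r m" "y \<in> G3_verts r m" "{x, y} \<in> G3_edges r m" for x y
    using f that by (auto simp: local_antimagic_labeling_def)
  have "?c Vu \<noteq> ?c Vv" "?c Vu \<noteq> ?c (Vx 1)" "?c Vv \<noteq> ?c (Vx 1)"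
    using assms(1) by (simp_all add: neq G3_verts_alt G3_edgesI)
  then have "3 = card {?c Vu, ?c Vv, ?c (Vx 1)}"
    by simp
  also have "\<dots> \<le> card (?c ` G3_verts r m)"
    using assms(1) by (intro card_mono) (auto simp: finite_G3_verts G3_verts_alt)
  finally show ?thesis
    by (simp add: color_number_def)
qed

text \<open>Besides the bound \<open>m + 1\<close>, the set of colors itself is recorded: when the
  bound is attained, it must be the whole color set.\<close>

lemma pendant_colors:
  fixes r m :: nat
  assumes f: "bij_betw f (G3_edges r m) {1..card (G3_edges r m)}"
  defines "P \<equiv> (\<lambda>j. f {Vu, Vy j}) ` {1..m}" and "c \<equiv> induced_label (G3_edges r m) f"
  shows "insert (c Vu) P \<subseteq> c ` G3_verts r m" "card (insert (c Vu) P) = m + 1"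
proof -
  have inj: "inj_on f (G3_edges r m)"
    using f by (simp add: bij_betw_def)
  have "inj_on (\<lambda>j. f {Vu, Vy j}) {1..m}"
    by (rule inj_onI) (auto simp: G3_edges_alt doubleton_eq_iff dest!: inj_onD[OF inj])
  then have "card P = m"
    by (simp add: P_def card_image)
  moreover have "c Vu \<notin> P"
  proof
    assume "c Vu \<in> P"
    then obtain j where j: "j \<in> {1..m}" "c Vu = f {Vu, Vy j}"
      by (auto simp: P_def)
    have "f {Vu, Vy j} \<le> (\<Sum>j = 1..m. f {Vu, Vy j})"
      using j(1) by (intro member_le_sum) auto
    \<comment> \<open>The positive label of \<open>uv\<close> makes the color of \<open>Vu\<close>
      strictly larger than every pendant label.\<close>
    moreover have "f {Vu, Vv} \<ge> 1"
      using f by (auto simp: bij_betw_def G3_edges_alt)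
    ultimately show False
      using j(2) by (simp add: c_def induced_label_Vu)
  qed
  ultimately show "card (insert (c Vu) P) = m + 1"
    by (simp add: P_def)
  have "P = c ` Vy ` {1..m}"
    by (auto simp: P_def c_def induced_label_Vy image_image)
  then show "insert (c Vu) P \<subseteq> c ` G3_verts r m"
    by (auto simp: G3_verts_alt)
qed

lemma color_number_ge_Suc:
  assumes "local_antimagic_labeling (G3_verts r m) (G3_edges r m) f"
  shows "m + 1 \<le> color_number (G3_verts r m) (G3_edges r m) f"
  using pendant_colors[of f r m] assms
  by (metis card_mono color_number_def finite_G3_verts finite_imageI local_antimagic_labeling_def)

text \<open>The \<open>r + 1\<close> edges at \<open>Vv\<close> carry distinct positive labels,
  whose sum is least for 1, ..., \<open>r + 1\<close>.\<close>

lemma label_Vv_ge: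
  assumes f: "bij_betw f (G3_edges r m) {1..card (G3_edges r m)}"
  shows "(r + 2) choose 2 \<le> induced_label (G3_edges r m) f Vv"
proof -
  let ?D = "{e \<in> G3_edges r m. Vv \<in> e}"
  have D: "?D \<subseteq> G3_edges r m"
    by auto
  have inj: "inj_on f ?D"
    using f by (auto simp: bij_betw_def intro: inj_on_subset)
  have fin: "finite ?D"
    using finite_G3_edges by simp
  have "{Vu, Vv} \<notin> (\<lambda>i. {Vv, Vx i}) ` {1..r}"
    by (auto simp: doubleton_eq_iff)
  then have "card ?D = r + 1"
    by (simp add: edges_at_Vv card_image inj_on_spokes)
  then have "card (f ` ?D) = r + 1"
    by (simp add: card_image inj)
  moreover have "f ` ?D \<subseteq> {1..card (G3_edges r m)}"
    using f D unfolding bij_betw_def by blast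
  then have "0 \<notin> f ` ?D"
    by auto
  \<comment> \<open>Adjoining 0 leaves the sum unchanged and allows comparison with the initial
    segment \<open>{0..<r + 2}\<close>.\<close>
  ultimately have "card (insert 0 (f ` ?D)) = r + 2"
    using fin by simp
  moreover have "\<Sum> {0..<card (insert 0 (f ` ?D))} \<le> \<Sum> (insert 0 (f ` ?D))"
    by (rule card_sum_le_nat_sum)
  moreover have "\<Sum> (insert 0 (f ` ?D)) = (\<Sum>e\<in>?D. f e)"
    using fin \<open>0 \<notin> f ` ?D\<close> by (simp add: sum.reindex inj)
  moreover have "\<Sum> {0..<r + 2} = (r + 2) choose 2"
    by (simp add: Sum_Ico_nat choose_two mult.commute)
  ultimately show ?thesis
    by (simp add: induced_label_def)
qed

text \<open>In this form the least possible color of \<open>Vv\<close> exceeds the largest label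
  \<open>2 * r + m + 1\<close> exactly when \<open>m < r choose 2\<close>.\<close>

lemma choose_two_add_two: "(r + 2) choose 2 = (r choose 2) + 2 * r + 1"
  by (simp add: numeral_2_eq_2)

lemma choose_two_ge_3_iff: "3 \<le> r choose 2 \<longleftrightarrow> 3 \<le> r"
proof (cases "r < 2")
  case False
  then obtain k where r: "r = k + 2"
    by (metis add.commute le_Suc_ex not_less)
  have "r choose 2 = (k choose 2) + 2 * k + 1"
    unfolding r by (rule choose_two_add_two)
  then show ?thesis
    using r by (cases "k = 0") (auto simp: binomial_eq_0)
qed (simp add: binomial_eq_0)

lemma color_number_ge_add_2:
  assumes f: "local_antimagic_labeling (G3_verts r m) (G3_edges r m) f"
    and "m < r choose 2"
  shows "m + 2 \<le> color_number (G3_verts r m) (G3_edges r m) f"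
proof (rule ccontr)
  let ?c = "induced_label (G3_edges r m) f"
  let ?P = "(\<lambda>j. f {Vu, Vy j}) ` {1..m}"
  assume "\<not> ?thesis"
  then have le: "card (?c ` G3_verts r m) \<le> m + 1"
    by (simp add: color_number_def)
  have bij: "bij_betw f (G3_edges r m) {1..card (G3_edges r m)}"
    using f by (simp add: local_antimagic_labeling_def)
  \<comment> \<open>The left side has \<open>m + 1\<close> elements and lies in a color set of at
    most that size.\<close>
  have "insert (?c Vu) ?P = ?c ` G3_verts r m"
    using pendant_colors[OF bij] le by (intro card_seteq) (auto simp: finite_G3_verts)
  then have "?c Vv \<in> insert (?c Vu) ?P"
    by (simp add: G3_verts_alt)
  moreover have "?c Vu \<noteq> ?c Vv"
    using f by (simp add: local_antimagic_labeling_def G3_verts_alt G3_edgesI)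
  ultimately have "?c Vv \<in> f ` G3_edges r m"
    by (auto simp: G3_edges_alt)
  then have "?c Vv \<le> 2 * r + m + 1"
    using bij by (simp add: bij_betw_def card_G3_edges)
  moreover have "(r + 2) choose 2 \<le> ?c Vv"
    using bij by (rule label_Vv_ge)
  ultimately show False
    using assms(2) unfolding choose_two_add_two by linarith
qed

section \<open>Labelings that attain the bounds\<close>

text \<open>The label of an edge, from the labels \<open>c\<close>, \<open>a i\<close>, \<open>b i\<close>, \<open>p j\<close> of
  \<open>uv\<close>, \<open>ux\<^sub>i\<close>, \<open>vx\<^sub>i\<close>, \<open>uy\<^sub>j\<close>.\<close>

definition book_label :: "nat \<Rightarrow> (nat \<Rightarrow> nat) \<Rightarrow> (nat \<Rightarrow> nat) \<Rightarrow> (nat \<Rightarrow> nat) \<Rightarrow> vertex set \<Rightarrow> nat" where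
  "book_label c a b p e =
     (if Vu \<in> e \<and> Vv \<in> e then c
      else if Vv \<in> e then b (THE i. Vx i \<in> e)
      else if \<exists>i. Vx i \<in> e then a (THE i. Vx i \<in> e)
      else p (THE j. Vy j \<in> e))"

lemma book_label_simps [simp]:
  "book_label c a b p {Vu, Vv} = c"
  "book_label c a b p {Vu, Vx i} = a i"
  "book_label c a b p {Vv, Vx i} = b i"
  "book_label c a b p {Vu, Vy j} = p j"
  by (simp_all add: book_label_def)

text \<open>Reduces a construction to arithmetic. All \<open>Vx i\<close> share the color
  \<open>s\<close>, itself a pendant label, so only the colors of \<open>Vu\<close> and
  \<open>Vv\<close> can be new.\<close>

lemma book_labeling:
  fixes a b p :: "nat \<Rightarrow> nat"
  assumes range: "insert c (a ` {1..r} \<union> b ` {1..r} \<union> p ` {1..m}) = {1..2 * r + m + 1}"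
    and x: "\<And>i. i \<in> {1..r} \<Longrightarrow> a i + b i = s" and s: "s \<in> p ` {1..m}"
    and v: "v = c + (\<Sum>i = 1..r. b i)" "v \<noteq> s" "v \<noteq> c + (\<Sum>i = 1..r. a i) + (\<Sum>j = 1..m. p j)"
  shows "\<exists>f. local_antimagic_labeling (G3_verts r m) (G3_edges r m) f \<and>
    color_number (G3_verts r m) (G3_edges r m) f \<le> (if v \<in> p ` {1..m} then m + 1 else m + 2)"
proof (intro exI conjI)
  define f where "f = book_label c a b p"
  define u where "u = c + (\<Sum>i = 1..r. a i) + (\<Sum>j = 1..m. p j)"
  let ?c = "induced_label (G3_edges r m) f"
  have f_simps [simp]: "f {Vu, Vv} = c" "f {Vu, Vx i} = a i" "f {Vv, Vx i} = b i" "f {Vu, Vy i} = p i" for i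
    by (simp_all add: f_def)
  have "f ` G3_edges r m = insert c (a ` {1..r} \<union> b ` {1..r} \<union> p ` {1..m})"
    by (simp add: G3_edges_alt image_Un image_image)
  \<comment> \<open>A surjection between finite sets of equal size is injective, so covering all
    labels already makes them distinct.\<close>
  then have img: "f ` G3_edges r m = {1..card (G3_edges r m)}"
    using range by (simp add: card_G3_edges)
  then have bij: "bij_betw f (G3_edges r m) {1..card (G3_edges r m)}"
    by (auto simp: bij_betw_def intro!: eq_card_imp_inj_on finite_G3_edges)
  have cu [simp]: "?c Vu = u" and cv [simp]: "?c Vv = v"
    by (simp_all add: induced_label_Vu induced_label_Vv u_def v(1))
  have cx [simp]: "?c (Vx i) = s" if "i \<in> {1..r}" for i
    using x[OF that] by (simp add: induced_label_Vx[OF that])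
  have cy [simp]: "?c (Vy j) = p j" if "j \<in> {1..m}" for j
    by (simp add: induced_label_Vy[OF that])
  have "c \<ge> 1"
    using range by auto
  have up: "p j < u" if "j \<in> {1..m}" for j
  proof -
    have "p j \<le> (\<Sum>j = 1..m. p j)"
      using that by (intro member_le_sum) auto
    then show ?thesis
      using \<open>c \<ge> 1\<close> by (simp add: u_def)
  qed
  then have "s < u"
    using s by auto
  have up_neq: "p j \<noteq> u" "u \<noteq> p j" if "j \<in> {1..m}" for j
    using up[OF that] by auto
  have "v \<noteq> u"
    using v(3) by (simp add: u_def)
  have neq: "?c x \<noteq> ?c y" if "{x, y} \<in> G3_edges r m" for x y
    using G3_edges_cases[OF that] v(2) \<open>v \<noteq> u\<close> \<open>s < u\<close>
    by (auto simp: doubleton_eq_iff up_neq)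
  then show "local_antimagic_labeling (G3_verts r m) (G3_edges r m) f"
    using connected_G3 bij by (simp add: local_antimagic_labeling_def)
  have "?c ` G3_verts r m \<subseteq> insert u (insert v (p ` {1..m}))"
    using s by (auto simp: G3_verts_alt)
  then have "card (?c ` G3_verts r m) \<le> card (insert u (insert v (p ` {1..m})))"
    by (intro card_mono) auto
  also have "\<dots> \<le> Suc (card (insert v (p ` {1..m})))"
    by (rule card_insert_le_m1) auto
  also have "card (insert v (p ` {1..m})) \<le> (if v \<in> p ` {1..m} then m else Suc m)"
    using card_image_le[of "{1..m}" p] by (auto simp: insert_absorb)
  finally show "color_number (G3_verts r m) (G3_edges r m) f \<le> (if v \<in> p ` {1..m} then m + 1 else m + 2)"
    by (simp add: color_number_def split: if_splits)
qed

text \<open>The guard \<open>r \<ge> 3\<close> matters at \<open>r = 1\<close>: there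
  \<open>r choose 2\<close> is 0, but the color 3 of \<open>Vv\<close> lies below the least pendant
  label 4.\<close>

lemma exists_labeling:
  assumes "r \<noteq> 2" "m \<ge> 1"
  shows "\<exists>f. local_antimagic_labeling (G3_verts r m) (G3_edges r m) f \<and>
    color_number (G3_verts r m) (G3_edges r m) f \<le> (if r \<ge> 3 \<and> r choose 2 \<le> m then m + 1 else m + 2)"
proof -
  let ?a = "\<lambda>i. 2 * r + 2 - i" and ?p = "\<lambda>j. 2 * r + 1 + j"
  let ?v = "(r + 1) + (\<Sum>i = 1..r. i)"
  have a: "?a ` {1..r} = {r + 2..2 * r + 1}"
  proof
    show "{r + 2..2 * r + 1} \<subseteq> ?a ` {1..r}"
    proof
      fix k assume "k \<in> {r + 2..2 * r + 1}"
      then show "k \<in> ?a ` {1..r}"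
        by (intro image_eqI[of _ _ "2 * r + 2 - k"]) auto
    qed
  qed auto
  have p: "?p ` {1..m} = {2 * r + 2..2 * r + 1 + m}"
    by (simp only: image_add_atLeastAtMost) simp
  have v: "?v = (r choose 2) + 2 * r + 1"
    by (induction r) (simp_all add: numeral_2_eq_2)
  \<comment> \<open>Equality would force \<open>r choose 2\<close> to be 1, that is
    \<open>r = 2\<close>; otherwise it is 0 or at least 3.\<close>
  have v_neq: "?v \<noteq> 2 * r + 2"
  proof (cases "r < 2")
    case True
    then have "r choose 2 = 0"
      by simp
    then show ?thesis
      unfolding v by linarith
  next
    case False
    then show ?thesis
      using assms(1) choose_two_ge_3_iff[of r] unfolding v by linarith
  qed
  \<comment> \<open>The smaller label of each pair sits at \<open>Vv\<close>, so its color stays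
    below that of \<open>Vu\<close>; a pendant edge makes this strict.\<close>
  have "(\<Sum>i = 1..r. i) \<le> (\<Sum>i = 1..r. ?a i)"
    by (intro sum_mono) auto
  moreover have "?p 1 \<le> (\<Sum>j = 1..m. ?p j)"
    using assms(2) by (intro member_le_sum) auto
  ultimately have "?v \<noteq> r + 1 + (\<Sum>i = 1..r. ?a i) + (\<Sum>j = 1..m. ?p j)"
    by linarith
  moreover have "insert (r + 1) (?a ` {1..r} \<union> (\<lambda>i. i) ` {1..r} \<union> ?p ` {1..m}) = {1..2 * r + m + 1}"
    unfolding a p image_ident by auto
  moreover have "2 * r + 2 \<in> ?p ` {1..m}"
    unfolding p using assms(2) by simp
  ultimately have "\<exists>f. local_antimagic_labeling (G3_verts r m) (G3_edges r m) f \<and>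
    color_number (G3_verts r m) (G3_edges r m) f \<le> (if ?v \<in> ?p ` {1..m} then m + 1 else m + 2)"
    using v_neq by (intro book_labeling[of "r + 1" ?a _ "\<lambda>i. i" _ _ "2 * r + 2"]) simp_all
  then obtain f where f: "local_antimagic_labeling (G3_verts r m) (G3_edges r m) f"
    "color_number (G3_verts r m) (G3_edges r m) f \<le> (if ?v \<in> ?p ` {1..m} then m + 1 else m + 2)"
    by blast
  have "?v \<in> ?p ` {1..m}" if "r \<ge> 3" "r choose 2 \<le> m"
    using choose_two_ge_3_iff[of r] that unfolding p v by simp
  with f show ?thesis
    by (intro exI[of _ f]) (auto split: if_splits)
qed

lemma exists_labeling_2:
  assumes "m = 1 \<or> m = 2"
  shows "\<exists>f. local_antimagic_labeling (G3_verts 2 m) (G3_edges 2 m) f \<and>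
    color_number (G3_verts 2 m) (G3_edges 2 m) f \<le> 3"
proof -
  have two: "{Suc 0..2} = {Suc 0, 2}"
    by auto
  from assms show ?thesis
  proof
    assume m: "m = 1"
    \<comment> \<open>Both pairs sum to the only pendant label 6; the third color, at
      \<open>Vv\<close>, is 3 + 5 + 2 = 10.\<close>
    let ?a = "\<lambda>i::nat. if i = 1 then 1 else 4 :: nat" and ?b = "\<lambda>i::nat. if i = 1 then 5 else 2 :: nat"
      and ?p = "\<lambda>_::nat. 6 :: nat"
    have "\<exists>f. local_antimagic_labeling (G3_verts 2 1) (G3_edges 2 1) f \<and>
        color_number (G3_verts 2 1) (G3_edges 2 1) f \<le> (if 10 \<in> ?p ` {1..1} then 1 + 1 else 1 + 2)"
      by (rule book_labeling[of 3 ?a _ ?b _ _ 6]) (auto simp: two)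
    then show ?thesis
      by (simp add: m del: One_nat_def add_2_eq_Suc')
  next
    assume m: "m = 2"
    \<comment> \<open>Both pairs sum to the pendant label 7, and \<open>Vv\<close> gets 1 + 2 + 3 =
      6, the other pendant label.\<close>
    let ?a = "\<lambda>i::nat. if i = 1 then 5 else 4 :: nat" and ?b = "\<lambda>i::nat. if i = 1 then 2 else 3 :: nat"
      and ?p = "\<lambda>j::nat. if j = 1 then 7 else 6 :: nat"
    have "\<exists>f. local_antimagic_labeling (G3_verts 2 2) (G3_edges 2 2) f \<and>
        color_number (G3_verts 2 2) (G3_edges 2 2) f \<le> (if 6 \<in> ?p ` {1..2} then 2 + 1 else 2 + 2)"
      by (rule book_labeling[of 1 ?a _ ?b _ _ 7]) (auto simp: two)
    then show ?thesis
      by (simp add: m two)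
  qed
qed

theorem theorem2p10:
  fixes r m :: nat
  assumes "r \<ge> 1" and "m \<ge> 1"
  shows "(m = 1 \<or> (r = 2 \<and> m = 2) \<longrightarrow> chi_la (G3_verts r m) (G3_edges r m) = 3) \<and>
         (m = 2 \<and> r \<ge> 3 \<longrightarrow> chi_la (G3_verts r m) (G3_edges r m) = 4) \<and>
         (m \<ge> r choose 2 \<and> r choose 2 \<ge> 3 \<longrightarrow>
            chi_la (G3_verts r m) (G3_edges r m) = m + 1) \<and>
         (3 \<le> m \<and> m < r choose 2 \<longrightarrow>
            chi_la (G3_verts r m) (G3_edges r m) = m + 2)"
proof (intro conjI impI)
  let ?V = "G3_verts r m" and ?E = "G3_edges r m"
  {
    assume *: "m = 1 \<or> (r = 2 \<and> m = 2)"
    obtain f where "local_antimagic_labeling ?V ?E f" "color_number ?V ?E f \<le> 3"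
    proof (cases "r = 2")
      case True
      then show ?thesis
        using exists_labeling_2[of m] * that by auto
    next
      case False
      then obtain f where f: "local_antimagic_labeling ?V ?E f"
        "color_number ?V ?E f \<le> (if r \<ge> 3 \<and> r choose 2 \<le> m then m + 1 else m + 2)"
        using exists_labeling[OF _ assms(2)] by blast
      from f(2) have "color_number ?V ?E f \<le> 3"
        using * False by (simp split: if_splits)
      with f(1) show ?thesis
        by (rule that)
    qed
    then show "chi_la ?V ?E = 3"
      using color_number_ge_3[OF assms(1)] by (rule chi_la_eqI)
  next
    assume *: "m = 2 \<and> r \<ge> 3"
    \<comment> \<open>Since 2 < 3, this is an instance of the \<open>m + 2\<close> regime.\<close>
    then have less: "m < r choose 2"
      using choose_two_ge_3_iff[of r] by linarith
    obtain f where f: "local_antimagic_labeling ?V ?E f" "color_number ?V ?E f \<le> m + 2"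
      using exists_labeling[of r m] * less by auto
    have "chi_la ?V ?E = m + 2"
      using f color_number_ge_add_2[OF _ less] by (rule chi_la_eqI)
    then show "chi_la ?V ?E = 4"
      using * by simp
  next
    assume *: "m \<ge> r choose 2 \<and> r choose 2 \<ge> 3"
    then obtain f where "local_antimagic_labeling ?V ?E f" "color_number ?V ?E f \<le> m + 1"
      using exists_labeling[of r m] choose_two_ge_3_iff[of r] assms(2) by fastforce
    then show "chi_la ?V ?E = m + 1"
      using color_number_ge_Suc by (rule chi_la_eqI)
  next
    assume *: "3 \<le> m \<and> m < r choose 2"
    then have "r \<ge> 3"
      using choose_two_ge_3_iff[of r] by linarith
    then obtain f where "local_antimagic_labeling ?V ?E f" "color_number ?V ?E f \<le> m + 2"
      using exists_labeling[of r m] * by auto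
    then show "chi_la ?V ?E = m + 2"
      using color_number_ge_add_2 * by (intro chi_la_eqI) auto
  }
qed

end
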